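(* Let $p$ be a prime and $\mathbb{K}$ a field of characteristic $p$. Let $q\geq p+1$ be an integer, and $f$ a power series with coefficients in $\mathbb{K}$ of the form $$f(z)=z\Bigl(1+\sum_{j=q}^{+\infty}a_jz^j\Bigr),\quad\text{with } a_q\neq 0.$$ Then for every $\ell_j\in\{0,1,\dots,q\}$ such that $\ell_j=q$ in $\mathbb{K}$ we have $$\iota_j(f)=-\frac{1}{a_q^{\ell_j+1}}\sum_{\substack{\alpha\in\mathbb{N}^{\ell_j+1}\\ |\alpha|=\ell_j,\ \|\alpha\|=\ell_j}}(-1)^{\ell_j-\alpha_0}\binom{\ell_j-\alpha_0}{\alpha_1,\ldots,\alpha_{\ell_j}}\prod_{i=0}^{\ell_j}a_{q+i}^{\alpha_i}.$$
   Context: $\mathbb{N}$ denotes the set of nonnegative integers. For $\alpha=(\alpha_0,\ldots,\alpha_{r})\in\mathbb{N}^{r+1}$, $|\alpha|=\sum_{i=0}^{r}\alpha_i$ and $\|\alpha\|=\sum_{i=1}^{r}i\,\alpha_i$. The symbol $\binom{\ell_j-\alpha_0}{\alpha_1,\ldots,\alpha_{\ell_j}}$ is the multinomial coefficient. Let $\ell_1<\ell_2<\cdots$ be the increasing enumeration of $\{\ell\in\{0,1,\dots,q\}:\ell=q\text{ in }\mathbb{K}\}$. For $f$ as in the statement, $\iota_j(f)$ denotes the coefficient of $\frac1z$ in the Laurent series expansion about $0$ of $\dfrac{z^{q-\ell_j}}{z-f(z)}$. *)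

theory Defs
  imports
    "HOL-Library.FuncSet"
    "HOL-Computational_Algebra.Computational_Algebra"
begin

definition resonant :: "'a::field itself \<Rightarrow> nat \<Rightarrow> nat set" where
  "resonant _ q = {l \<in> {0..q}. (of_nat l :: 'a) = of_nat q}"

text \<open>The increasing enumeration of \<^const>\<open>resonant\<close>, indexed from 1:
  only indices \<open>j\<close> with \<open>1 \<le> j \<le> card (resonant TYPE('a) q)\<close> are meaningful.\<close>

definition ell :: "'a::field itself \<Rightarrow> nat \<Rightarrow> nat \<Rightarrow> nat" where
  "ell T q j = sorted_list_of_set (resonant T q) ! (j - 1)"

text \<open>\<^const>\<open>fls_residue\<close> is the coefficient of \<open>1/z\<close>. The parameter \<open>q\<close> is
  determined by \<open>f\<close>, since \<open>q + 1\<close> is the order of vanishing of \<open>z - f(z)\<close>.\<close>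

definition iota :: "nat \<Rightarrow> nat \<Rightarrow> 'a::field fps \<Rightarrow> 'a" where
  "iota q j f = fls_residue (fls_X ^ (q - ell TYPE('a) q j) / (fls_X - fps_to_fls f))"

text \<open>Multi-indices in \<open>\<nat>\<^bsup>r+1\<^esup>\<close> are the functions in
  \<open>{0..r} \<rightarrow>\<^sub>E UNIV\<close>; being extensional, each occurs only once in a sum.\<close>

definition multi_indices :: "nat \<Rightarrow> (nat \<Rightarrow> nat) set" where
  "multi_indices r = {0..r} \<rightarrow>\<^sub>E UNIV"

definition mi_length :: "nat \<Rightarrow> (nat \<Rightarrow> nat) \<Rightarrow> nat" where
  "mi_length r \<alpha> = (\<Sum>i=0..r. \<alpha> i)"

definition mi_weight :: "nat \<Rightarrow> (nat \<Rightarrow> nat) \<Rightarrow> nat" where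
  "mi_weight r \<alpha> = (\<Sum>i=1..r. i * \<alpha> i)"

text \<open>The multinomial coefficient of \<open>n\<close> over \<open>\<alpha>\<^sub>1, \<dots>, \<alpha>\<^sub>r\<close>, meant for
  \<open>\<alpha>\<^sub>1 + \<dots> + \<alpha>\<^sub>r = n\<close>, where the division is exact.\<close>

definition multinomial :: "nat \<Rightarrow> nat \<Rightarrow> (nat \<Rightarrow> nat) \<Rightarrow> nat" where
  "multinomial r n \<alpha> = fact n div (\<Prod>i=1..r. fact (\<alpha> i))"

end

theory Submission
  imports Defs
begin

text \<open>
  Write \<open>A = \<Sum>\<^sub>k a\<^bsub>q+k\<^esub> z\<^sup>k\<close>, so that \<open>z - f(z) = - z\<^bsup>q+1\<^esup> A\<close> with \<open>A(0) = a\<^sub>q \<noteq> 0\<close>. Then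
  \<open>z\<^bsup>q-l\<^esup> / (z - f(z)) = - z\<^bsup>-l-1\<^esup> / A\<close>, and its residue is minus the coefficient of \<open>z\<^sup>l\<close>
  in the reciprocal of \<open>A\<close>. The theorem is thus an instance of a formula for the
  coefficients of the reciprocal of a power series (\<open>fps_inverse_nth_multi_index\<close>).

  To obtain this formula, let \<open>c = A(0)\<close> and let \<open>T\<close> be the sum of the terms of \<open>A\<close> of degrees
  \<open>1, \<dots>, l\<close>. The finite geometric sum \<open>P = \<Sum>\<^bsub>t\<le>l\<^esub> c\<^sup>t (-T)\<^bsup>l-t\<^esup>\<close> satisfies
  \<open>(c + T) P = c\<^bsup>l+1\<^esup> - (-T)\<^bsup>l+1\<^esup>\<close>; since \<open>A \<equiv> c + T\<close> and \<open>T\<^bsup>l+1\<^esup> \<equiv> 0\<close> modulo \<open>z\<^bsup>l+1\<^esup>\<close>,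
  the reciprocal of \<open>A\<close> agrees with \<open>P / c\<^bsup>l+1\<^esup>\<close> up to degree \<open>l\<close>
  (\<open>fps_inverse_nth_geometric\<close>). The multinomial theorem expands each \<open>T\<^bsup>l-t\<^esup>\<close> as a sum over
  \<open>(\<alpha>\<^sub>1, \<dots>, \<alpha>\<^sub>l)\<close>, the coefficient of \<open>z\<^sup>l\<close> selects the weight \<open>\<Sum> i \<alpha>\<^sub>i = l\<close>, and the exponent
  \<open>t\<close> of \<open>c\<close> takes the place of \<open>\<alpha>\<^sub>0\<close>.
\<close>

section \<open>The multinomial theorem\<close>

lemma finite_PiE_sum_eq:
  fixes n :: nat
  assumes "finite I"
  shows "finite {\<alpha>. \<alpha> \<in> I \<rightarrow>\<^sub>E UNIV \<and> sum \<alpha> I = n}"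
proof (rule finite_subset)
  show "{\<alpha>. \<alpha> \<in> I \<rightarrow>\<^sub>E UNIV \<and> sum \<alpha> I = n} \<subseteq> I \<rightarrow>\<^sub>E {..n}"
    using member_le_sum[of _ I] assms by (fastforce simp: PiE_iff)
  show "finite (I \<rightarrow>\<^sub>E {..n})"
    using assms by (intro finite_PiE) auto
qed

text \<open>
  Splitting off one coordinate serves twice: as the induction step of the multinomial theorem,
  and to turn a sum over multi-indices with a zeroth component into a double sum.
\<close>

lemma sum_PiE_insert:
  fixes n :: nat and g :: "('b \<Rightarrow> nat) \<Rightarrow> 'c::comm_monoid_add"
  assumes "finite J" and "k \<notin> J"
  shows "(\<Sum>\<alpha> | \<alpha> \<in> insert k J \<rightarrow>\<^sub>E UNIV \<and> sum \<alpha> (insert k J) = n. g \<alpha>) =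
    (\<Sum>t\<le>n. \<Sum>\<beta> | \<beta> \<in> J \<rightarrow>\<^sub>E UNIV \<and> sum \<beta> J = n - t. g (\<beta>(k := t)))"
proof -
  have upd: "(\<Sum>i\<in>J. if i = k then t else \<beta> i) = sum \<beta> J" for \<beta> :: "'b \<Rightarrow> nat" and t
    using assms by (intro sum.cong) auto
  have "(\<Sum>t\<le>n. \<Sum>\<beta> | \<beta> \<in> J \<rightarrow>\<^sub>E UNIV \<and> sum \<beta> J = n - t. g (\<beta>(k := t))) =
      (\<Sum>(t, \<beta>) \<in> Sigma {..n} (\<lambda>t. {\<beta>. \<beta> \<in> J \<rightarrow>\<^sub>E UNIV \<and> sum \<beta> J = n - t}). g (\<beta>(k := t)))"
    using assms by (intro sum.Sigma) (auto intro: finite_PiE_sum_eq)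
  also have "\<dots> = (\<Sum>\<alpha> | \<alpha> \<in> insert k J \<rightarrow>\<^sub>E UNIV \<and> sum \<alpha> (insert k J) = n. g \<alpha>)"
    using assms
    by (intro sum.reindex_bij_witness[where i = "\<lambda>\<alpha>. (\<alpha> k, \<alpha>(k := undefined))"
          and j = "\<lambda>(t, \<beta>). \<beta>(k := t)"])
       (auto simp: upd PiE_iff extensional_def fun_eq_iff)
  finally show ?thesis ..
qed

lemma prod_fact_dvd_fact_sum:
  fixes \<alpha> :: "'b \<Rightarrow> nat"
  assumes "finite I"
  shows "(\<Prod>i\<in>I. fact (\<alpha> i)) dvd (fact (sum \<alpha> I) :: nat)"
  using assms
proof (induction I)
  case (insert k J)
  have "(\<Prod>i\<in>insert k J. fact (\<alpha> i)) dvd (fact (\<alpha> k) * fact (sum \<alpha> J) :: nat)"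
    using insert by (simp add: mult_dvd_mono)
  also have "\<dots> dvd fact (\<alpha> k + sum \<alpha> J)"
    by (rule fact_fact_dvd_fact)
  finally show ?case
    using insert by simp
qed simp

text \<open>
  As the quotients are taken in \<^typ>\<open>nat\<close>, the usual cancellation of factorials rests on
  \<open>prod_fact_dvd_fact_sum\<close>. Exact quotients in \<^typ>\<open>nat\<close>, embedded by \<^const>\<open>of_nat\<close>
  afterwards, keep the identity meaningful where factorials vanish, as in characteristic \<open>p\<close>.
\<close>

lemma multinomial_coeff_insert:
  fixes \<beta> :: "'b \<Rightarrow> nat" and n t :: nat
  assumes "finite J" and "k \<notin> J" and "t \<le> n" and "sum \<beta> J = n - t"
  shows "fact n div (\<Prod>i\<in>insert k J. fact ((\<beta>(k := t)) i)) =
    (n choose t) * (fact (n - t) div (\<Prod>i\<in>J. fact (\<beta> i)) :: nat)"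
proof -
  define P :: nat where "P = (\<Prod>i\<in>J. fact (\<beta> i))"
  have "P dvd fact (n - t)"
    using prod_fact_dvd_fact_sum[of J \<beta>] assms by (simp add: P_def)
  then obtain d where d: "fact (n - t) = P * d" ..
  have "P > 0"
    by (simp add: P_def prod_pos)
  have "(\<Prod>i\<in>J. fact ((\<beta>(k := t)) i)) = P"
    unfolding P_def using assms by (intro prod.cong) auto
  hence "(\<Prod>i\<in>insert k J. fact ((\<beta>(k := t)) i)) = fact t * P"
    using assms by simp
  moreover have "fact n = (fact t * P) * ((n choose t) * d)"
    using binomial_fact_lemma[OF assms(3)] d by (simp add: mult_ac)
  ultimately show ?thesis
    using \<open>P > 0\<close> d by (simp flip: P_def)
qed

theorem multinomial_theorem:
  fixes x :: "'b \<Rightarrow> 'c::comm_semiring_1"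
  assumes "finite I"
  shows "(\<Sum>i\<in>I. x i) ^ n =
    (\<Sum>\<alpha> | \<alpha> \<in> I \<rightarrow>\<^sub>E UNIV \<and> sum \<alpha> I = n.
       of_nat (fact n div (\<Prod>i\<in>I. fact (\<alpha> i))) * (\<Prod>i\<in>I. x i ^ \<alpha> i))"
  using assms
proof (induction I arbitrary: n)
  case empty
  have "{\<alpha>. \<alpha> = (\<lambda>_. undefined) \<and> n = 0} = (if n = 0 then {\<lambda>_::'b. undefined :: nat} else {})"
    by auto
  thus ?case
    by (auto simp: power_0_left)
next
  case (insert k J)
  have summand: "of_nat (fact n div (\<Prod>i\<in>insert k J. fact ((\<beta>(k := t)) i))) *
        (\<Prod>i\<in>insert k J. x i ^ (\<beta>(k := t)) i) =
      of_nat (n choose t) * x k ^ t *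
        (of_nat (fact (n - t) div (\<Prod>i\<in>J. fact (\<beta> i))) * (\<Prod>i\<in>J. x i ^ \<beta> i))"
    if "t \<le> n" "sum \<beta> J = n - t" for t \<beta>
  proof -
    have "(\<Prod>i\<in>J. x i ^ (\<beta>(k := t)) i) = (\<Prod>i\<in>J. x i ^ \<beta> i)"
      using insert by (intro prod.cong) auto
    thus ?thesis
      unfolding multinomial_coeff_insert[OF insert.hyps that]
      using insert.hyps by (simp add: mult_ac)
  qed
  have "(\<Sum>i\<in>insert k J. x i) ^ n =
      (\<Sum>t\<le>n. of_nat (n choose t) * x k ^ t * (\<Sum>i\<in>J. x i) ^ (n - t))"
    using insert.hyps by (simp add: binomial_ring)
  also have "\<dots> = (\<Sum>t\<le>n. \<Sum>\<beta> | \<beta> \<in> J \<rightarrow>\<^sub>E UNIV \<and> sum \<beta> J = n - t.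
      of_nat (n choose t) * x k ^ t *
        (of_nat (fact (n - t) div (\<Prod>i\<in>J. fact (\<beta> i))) * (\<Prod>i\<in>J. x i ^ \<beta> i)))"
    by (simp add: insert.IH sum_distrib_left)
  also have "\<dots> = (\<Sum>t\<le>n. \<Sum>\<beta> | \<beta> \<in> J \<rightarrow>\<^sub>E UNIV \<and> sum \<beta> J = n - t.
      of_nat (fact n div (\<Prod>i\<in>insert k J. fact ((\<beta>(k := t)) i))) *
        (\<Prod>i\<in>insert k J. x i ^ (\<beta>(k := t)) i))"
    by (intro sum.cong refl summand[symmetric]) auto
  also have "\<dots> = (\<Sum>\<alpha> | \<alpha> \<in> insert k J \<rightarrow>\<^sub>E UNIV \<and> sum \<alpha> (insert k J) = n.
       of_nat (fact n div (\<Prod>i\<in>insert k J. fact (\<alpha> i))) * (\<Prod>i\<in>insert k J. x i ^ \<alpha> i))"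
    by (rule sum_PiE_insert[OF insert.hyps, symmetric])
  finally show ?case .
qed

text \<open>
  Each term of the multinomial expansion is a single monomial, whose degree is the weight of
  the multi-index.
\<close>

lemma fps_power_of_sum_monomials_nth:
  fixes b :: "nat \<Rightarrow> 'a::comm_semiring_1"
  assumes "finite I"
  shows "(\<Sum>i\<in>I. fps_const (b i) * fps_X ^ i) ^ m $ n =
    (\<Sum>\<alpha> | \<alpha> \<in> I \<rightarrow>\<^sub>E UNIV \<and> sum \<alpha> I = m.
       if (\<Sum>i\<in>I. i * \<alpha> i) = n
       then of_nat (fact m div (\<Prod>i\<in>I. fact (\<alpha> i))) * (\<Prod>i\<in>I. b i ^ \<alpha> i) else 0)"
proof -
  have "(of_nat N * (\<Prod>i\<in>I. (fps_const (b i) * fps_X ^ i) ^ \<alpha> i)) $ n =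
      (if (\<Sum>i\<in>I. i * \<alpha> i) = n then of_nat N * (\<Prod>i\<in>I. b i ^ \<alpha> i) else 0)"
    for \<alpha> and N :: nat
  proof -
    have const: "(\<Prod>i\<in>I. fps_const (c i)) = fps_const (\<Prod>i\<in>I. c i)" for c :: "nat \<Rightarrow> 'a"
      by (induction I rule: infinite_finite_induct) auto
    have "(\<Prod>i\<in>I. (fps_const (b i) * fps_X ^ i) ^ \<alpha> i) =
        fps_const (\<Prod>i\<in>I. b i ^ \<alpha> i) * fps_X ^ (\<Sum>i\<in>I. i * \<alpha> i)"
      by (simp add: power_mult_distrib prod.distrib power_mult[symmetric]
          power_sum fps_const_power const)
    thus ?thesis
      by (simp add: fps_of_nat[symmetric] mult.assoc[symmetric])
  qed
  thus ?thesis
    by (simp add: multinomial_theorem[OF assms] fps_sum_nth)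
qed

section \<open>Coefficients of the reciprocal of a power series\<close>

lemma fps_mult_nth_eq_0:
  fixes g h :: "'a::semiring_0 fps"
  assumes "\<And>i. i \<le> n \<Longrightarrow> h $ i = 0"
  shows "(g * h) $ n = 0"
  using assms by (simp add: fps_mult_nth)

text \<open>
  Division by \<open>A\<close> up to degree \<open>l\<close> needs only its truncation \<open>c + T\<close>. Multiplying the geometric
  series through by \<open>c\<^bsup>l+1\<^esup>\<close> leaves nonnegative powers of \<open>c\<close> with exponent \<open>t\<close> running over
  \<open>0, \<dots>, l\<close>.
\<close>

lemma fps_inverse_nth_geometric:
  fixes A :: "'a::field fps" and l :: nat
  assumes "A $ 0 \<noteq> 0"
  defines "T \<equiv> (\<Sum>i=1..l. fps_const (A $ i) * fps_X ^ i)"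
  shows "(A $ 0) ^ (l + 1) * inverse A $ l =
    (\<Sum>t\<le>l. (A $ 0) ^ t * ((- 1) ^ (l - t) * T ^ (l - t) $ l))"
proof -
  define c where "c = fps_const (A $ 0)"
  define P where "P = (\<Sum>t\<le>l. c ^ t * (- T) ^ (l - t))"
  (* E measures how far P is from c ^ (l + 1) / A; it vanishes up to degree l. *)
  define E where "E = A * P - c ^ (l + 1)"
  have neg: "(- T) ^ m = fps_const ((- 1) ^ m) * T ^ m" for m
    by (subst power_minus) (simp flip: fps_const_power fps_const_neg)
  have T_nth: "T $ n = (if n \<in> {1..l} then A $ n else 0)" for n
    unfolding T_def by (simp add: fps_sum_nth if_distrib sum.delta cong: if_cong)
  have geometric: "(c + T) * P = c ^ (l + 1) - (- T) ^ (l + 1)"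
    using diff_power_eq_sum[of c l "- T"] by (simp add: P_def lessThan_Suc_atMost)
  have "E = P * (A - (c + T)) - (- T) ^ (l + 1)"
    unfolding E_def using geometric by (simp add: algebra_simps)
  moreover have "(P * (A - (c + T))) $ n = 0" if "n \<le> l" for n
    using that by (intro fps_mult_nth_eq_0) (auto simp: c_def T_nth not_le)
  moreover have "((- T) ^ (l + 1)) $ n = 0" if "n \<le> l" for n
    using startsby_zero_power_prefix[of "- T" "l + 1"] that T_nth[of 0] by simp
  ultimately have "E $ n = 0" if "n \<le> l" for n
    using that by simp
  hence "(inverse A * E) $ l = 0"
    by (intro fps_mult_nth_eq_0)
  moreover have "inverse A * E = P - fps_const ((A $ 0) ^ (l + 1)) * inverse A"
    using inverse_mult_eq_1[OF assms(1)]
    by (simp add: E_def c_def right_diff_distrib mult.assoc[symmetric] fps_const_power mult.commute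
        del: power_Suc)
  ultimately have "(A $ 0) ^ (l + 1) * inverse A $ l = P $ l"
    by simp
  also have "P $ l = (\<Sum>t\<le>l. (A $ 0) ^ t * ((- 1) ^ (l - t) * T ^ (l - t) $ l))"
    by (simp add: P_def c_def neg fps_sum_nth fps_const_power)
  finally show ?thesis .
qed

theorem fps_inverse_nth_multi_index:
  fixes A :: "'a::field fps"
  assumes "A $ 0 \<noteq> 0"
  shows "inverse A $ l = 1 / (A $ 0) ^ (l + 1) *
    (\<Sum>\<alpha> | \<alpha> \<in> multi_indices l \<and> mi_length l \<alpha> = l \<and> mi_weight l \<alpha> = l.
       (- 1) ^ (l - \<alpha> 0) * of_nat (multinomial l (l - \<alpha> 0) \<alpha>) * (\<Prod>i=0..l. (A $ i) ^ \<alpha> i))"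
proof -
  (* Encoding the weight condition in the summand leaves an index set given by the length alone,
     from which the zeroth component can be split off. *)
  define g where "g \<alpha> = (if mi_weight l \<alpha> = l then
      (- 1) ^ (l - \<alpha> 0) * of_nat (multinomial l (l - \<alpha> 0) \<alpha>) * (\<Prod>i=0..l. (A $ i) ^ \<alpha> i)
    else 0)" for \<alpha>
  define T where "T = (\<Sum>i=1..l. fps_const (A $ i) * fps_X ^ i)"
  have split: "{0..l} = insert 0 {1..l}"
    by auto
  have g_upd: "g (\<beta>(0 := t)) = (A $ 0) ^ t * ((- 1) ^ (l - t) *
      (if (\<Sum>i=1..l. i * \<beta> i) = l
       then of_nat (fact (l - t) div (\<Prod>i=1..l. fact (\<beta> i))) * (\<Prod>i=1..l. (A $ i) ^ \<beta> i) else 0))"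
    for \<beta> t
  proof -
    have [simp]: "mi_weight l (\<beta>(0 := t)) = (\<Sum>i=1..l. i * \<beta> i)"
      unfolding mi_weight_def by (intro sum.cong) auto
    have [simp]: "multinomial l (l - t) (\<beta>(0 := t)) = fact (l - t) div (\<Prod>i=1..l. fact (\<beta> i))"
      unfolding multinomial_def by (intro arg_cong2[where f = "(div)"] refl prod.cong) auto
    have "(\<Prod>i=1..l. (A $ i) ^ (\<beta>(0 := t)) i) = (\<Prod>i=1..l. (A $ i) ^ \<beta> i)"
      by (intro prod.cong) auto
    hence [simp]: "(\<Prod>i=0..l. (A $ i) ^ (\<beta>(0 := t)) i) = (A $ 0) ^ t * (\<Prod>i=1..l. (A $ i) ^ \<beta> i)"
      unfolding split by (simp del: fun_upd_apply) (simp add: fun_upd_apply)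
    show ?thesis
      by (simp add: g_def del: fun_upd_apply) (simp add: fun_upd_apply)
  qed
  have fin: "finite {\<alpha>. \<alpha> \<in> multi_indices l \<and> mi_length l \<alpha> = l}"
    unfolding multi_indices_def mi_length_def by (rule finite_PiE_sum_eq) simp
  have "(\<Sum>\<alpha> | \<alpha> \<in> multi_indices l \<and> mi_length l \<alpha> = l \<and> mi_weight l \<alpha> = l.
       (- 1) ^ (l - \<alpha> 0) * of_nat (multinomial l (l - \<alpha> 0) \<alpha>) * (\<Prod>i=0..l. (A $ i) ^ \<alpha> i)) =
      (\<Sum>\<alpha> | \<alpha> \<in> multi_indices l \<and> mi_length l \<alpha> = l. g \<alpha>)"
    unfolding g_def by (subst sum.inter_filter[OF fin, symmetric]) (simp add: conj_assoc)
  also have "\<dots> = (\<Sum>t\<le>l. \<Sum>\<beta> | \<beta> \<in> {1..l} \<rightarrow>\<^sub>E UNIV \<and> sum \<beta> {1..l} = l - t. g (\<beta>(0 := t)))"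
    unfolding multi_indices_def mi_length_def split by (rule sum_PiE_insert) auto
  also have "\<dots> = (\<Sum>t\<le>l. (A $ 0) ^ t * ((- 1) ^ (l - t) * T ^ (l - t) $ l))"
    unfolding g_upd T_def
    by (subst fps_power_of_sum_monomials_nth) (simp_all only: finite_atLeastAtMost sum_distrib_left)
  also have "\<dots> = (A $ 0) ^ (l + 1) * inverse A $ l"
    unfolding T_def by (rule fps_inverse_nth_geometric[OF assms, symmetric])
  finally show ?thesis
    using assms by simp
qed

section \<open>The residue\<close>

text \<open>
  Multiplying the quotient by \<open>z\<^bsup>l+1\<^esup>\<close> gives the power series of \<open>- 1 / A\<close> and moves the
  residue to degree \<open>l\<close>.
\<close>

lemma fls_residue_X_power_divide:
  fixes A :: "'a::field fps"
  assumes "A $ 0 \<noteq> 0" and "l \<le> q"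
  shows "fls_residue (fls_X ^ (q - l) / (- (fls_X ^ (q + 1) * fps_to_fls A))) = - inverse A $ l"
proof -
  define G where "G = fls_X ^ (q - l) / (- (fls_X ^ (q + 1) * fps_to_fls A))"
  have inv: "inverse (fps_to_fls A) = fps_to_fls (inverse A)"
    using assms(1) by (intro fls_inverse_fps_to_fls) simp
  have pow: "fls_X ^ (q + 1) = fls_X ^ (q - l) * (fls_X ^ (l + 1) :: 'a fls)"
    using assms(2) by (simp flip: power_add)
  have nz: "(fls_X :: 'a fls) ^ n \<noteq> 0" for n
    by simp
  have "fps_to_fls A \<noteq> 0"
    using assms(1) by auto
  hence "G * fls_X ^ (l + 1) = - inverse (fps_to_fls A)"
    unfolding G_def pow using nz[of "q - l"] nz[of "l + 1"]
    by (simp add: field_simps del: power_Suc)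
  hence "fls_nth (G * fls_X ^ (l + 1)) (int l) = - inverse A $ l"
    by (simp add: inv del: power_Suc)
  moreover have "fls_nth (G * fls_X ^ (l + 1)) (int l) = fls_nth G (- 1)"
    by (simp only: fls_X_power_times_conv_shift fls_shift_nth) simp
  ultimately show ?thesis
    by (simp add: G_def)
qed

theorem proposition6p1:
  fixes p q j l :: nat
    and a :: "nat \<Rightarrow> 'a::field"
    and f :: "'a fps"
  assumes "prime p"
    and "CHAR('a) = p"
    and "q \<ge> p + 1"
    and "f = fps_X * (1 + Abs_fps (\<lambda>k. if k \<ge> q then a k else 0))"
    and "a q \<noteq> 0"
    and "j \<in> {1..card (resonant TYPE('a) q)}"
    and "l = ell TYPE('a) q j"
  shows "iota q j f =
    - (1 / a q ^ (l + 1)) *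
      (\<Sum>\<alpha> | \<alpha> \<in> multi_indices l \<and> mi_length l \<alpha> = l \<and> mi_weight l \<alpha> = l.
         (- 1) ^ (l - \<alpha> 0) * of_nat (multinomial l (l - \<alpha> 0) \<alpha>) * (\<Prod>i=0..l. a (q + i) ^ \<alpha> i))"
proof -
  define A where "A = Abs_fps (\<lambda>k. a (q + k))"
  have "finite (resonant TYPE('a) q)"
    by (simp add: resonant_def)
  hence "l \<in> resonant TYPE('a) q"
    using assms(6,7) nth_mem[of "j - 1" "sorted_list_of_set (resonant TYPE('a) q)"]
    by (auto simp: ell_def)
  hence "l \<le> q"
    by (simp add: resonant_def)
  have "fps_X - f = - (fps_X ^ (q + 1) * A)"
    unfolding assms(4) A_def
    by (rule fps_ext) (auto simp: fps_X_power_mult_nth distrib_left simp del: power_Suc)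
  hence "fls_X - fps_to_fls f = - (fls_X ^ (q + 1) * fps_to_fls A)"
    by (metis fps_X_to_fls fps_to_fls_minus fps_to_fls_power fls_times_fps_to_fls fps_to_fls_uminus)
  hence "iota q j f = - inverse A $ l"
    unfolding iota_def assms(7)[symmetric]
    using fls_residue_X_power_divide[of A l q] \<open>l \<le> q\<close> assms(5) by (simp add: A_def)
  also have "\<dots> = - (1 / a q ^ (l + 1)) *
      (\<Sum>\<alpha> | \<alpha> \<in> multi_indices l \<and> mi_length l \<alpha> = l \<and> mi_weight l \<alpha> = l.
         (- 1) ^ (l - \<alpha> 0) * of_nat (multinomial l (l - \<alpha> 0) \<alpha>) * (\<Prod>i=0..l. a (q + i) ^ \<alpha> i))"
    using fps_inverse_nth_multi_index[of A l] assms(5) by (simp add: A_def)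
  finally show ?thesis .
qed

end
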